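(* For every positive integer $m$, there exists an $m$-uniform shift-chain $\mathcal{H} = ([n], \mathcal{E})$ that has no polychromatic $3$-coloring; that is, for every map $c : [n] \to \{1,2,3\}$ there is an edge $A \in \mathcal{E}$ such that $\{c(a) : a \in A\} \neq \{1,2,3\}$.
   Context: An ordered $m$-uniform hypergraph $\mathcal{H} = (V, \mathcal{E})$ has vertex set $V = [n] = \{1,\ldots,n\}$ for some positive integer $n$ and edge set $\mathcal{E} \subseteq V^m$, where every edge $A = (a_1,\ldots,a_m) \in \mathcal{E}$ satisfies $a_1 < a_2 < \cdots < a_m$. Two edges $A = (a_1,\ldots,a_m)$ and $B = (b_1,\ldots,b_m)$ are comparable if $a_i \le b_i$ for all $i \in [m]$ or $b_i \le a_i$ for all $i \in [m]$. An ordered $m$-uniform hypergraph is an $m$-uniform shift-chain if any two of its edges are comparable. A polychromatic $3$-coloring of a hypergraph is a coloring of its vertices with three colors such that every edge contains vertices of all three colors. *)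

theory Defs
  imports Main "HOL-Library.FuncSet"
begin

text \<open>A tuple in \<open>V\<^sup>m\<close> is a list of length \<open>m\<close> over \<open>V\<close>.\<close>

definition ordered_hypergraph :: "nat \<Rightarrow> nat \<Rightarrow> nat list set \<Rightarrow> bool" where
  "ordered_hypergraph m n E \<longleftrightarrow>
     n \<ge> 1 \<and> (\<forall>A\<in>E. length A = m \<and> set A \<subseteq> {1..n} \<and> sorted_wrt (<) A)"

definition comparable :: "nat list \<Rightarrow> nat list \<Rightarrow> bool" where
  "comparable A B \<longleftrightarrow> list_all2 (\<le>) A B \<or> list_all2 (\<le>) B A"

definition shift_chain :: "nat \<Rightarrow> nat \<Rightarrow> nat list set \<Rightarrow> bool" where
  "shift_chain m n E \<longleftrightarrow>
     ordered_hypergraph m n E \<and> (\<forall>A\<in>E. \<forall>B\<in>E. comparable A B)"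

definition polychromatic_3_coloring :: "nat \<Rightarrow> nat list set \<Rightarrow> (nat \<Rightarrow> nat) \<Rightarrow> bool" where
  "polychromatic_3_coloring n E c \<longleftrightarrow>
     c \<in> {1..n} \<rightarrow> {1, 2, 3} \<and> (\<forall>A\<in>E. c ` set A = {1, 2, 3})"

end

theory Submission
  imports Defs
begin

text \<open>
  Induction on \<open>m\<close>. Let \<open>E\<close> be a bad \<open>m\<close>-uniform shift-chain on \<open>[n]\<close>. Attach to its edges \<open>A\<close>,
  in increasing order, disjoint blocks \<open>R\<^sub>A\<close> of \<open>m\<close> consecutive new vertices to the right of \<open>n\<close>,
  and let \<open>q\<close> be a vertex to the right of all blocks. The new edges are \<open>A \<union> {r}\<close> with \<open>r \<in> R\<^sub>A\<close>,
  and \<open>R\<^sub>A \<union> {q}\<close>. In a 3-coloring some \<open>A \<in> E\<close> misses a color \<open>k\<close>. If the edges \<open>A \<union> {r}\<close> see all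
  colors, then \<open>R\<^sub>A\<close> is monochromatic of color \<open>k\<close>, so \<open>R\<^sub>A \<union> {q}\<close> sees at most two colors.

  The edges are ordered by their vertex sums, which increase strictly along the chain.
\<close>

lemma list_all2_le_sum_list:
  fixes A B :: "nat list"
  assumes "list_all2 (\<le>) A B"
  shows "sum_list A \<le> sum_list B"
  using assms by (induction rule: list_all2_induct) auto

text \<open>Coordinates that only grow while their total stays fixed cannot change. Hence the vertex
  sum separates the edges of a chain and can serve as their index.\<close>

lemma list_all2_le_sum_list_eq:
  fixes A B :: "nat list"
  assumes "list_all2 (\<le>) A B" and "sum_list A = sum_list B"
  shows "A = B"
  using assms
proof (induction rule: list_all2_induct)
  case (Cons x xs y ys)
  then show ?case using list_all2_le_sum_list[of xs ys] by auto
qed simp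

lemma sum_list_le_length_mult:
  fixes A :: "nat list"
  assumes "set A \<subseteq> {1..n}"
  shows "sum_list A \<le> length A * n"
  using assms by (induction A) auto

text \<open>Offsetting by \<open>m * sum_list A\<close> avoids enumerating the chain: distinct sums
  give disjoint blocks, and gaps between blocks do no harm.\<close>

definition block :: "nat \<Rightarrow> nat \<Rightarrow> nat list \<Rightarrow> nat list" where
  "block m n A = [n + m * sum_list A + 1..<n + m * sum_list A + m + 1]"

text \<open>An edge has sum at most \<open>m * n\<close>, so \<open>n + m * (m * n) + m\<close>
  bounds every block.\<close>

definition last_vertex :: "nat \<Rightarrow> nat \<Rightarrow> nat" where
  "last_vertex m n = n + m * (m * n) + m + 1"

definition extend :: "nat \<Rightarrow> nat \<Rightarrow> nat list set \<Rightarrow> nat list set" where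
  "extend m n E = {A @ [r] | A r. A \<in> E \<and> r \<in> set (block m n A)}
     \<union> {block m n A @ [last_vertex m n] | A. A \<in> E}"

lemma length_block [simp]: "length (block m n A) = m"
  by (simp add: block_def)

lemma block_gt: "r \<in> set (block m n A) \<Longrightarrow> n < r"
  by (auto simp: block_def)

lemma block_less_last_vertex:
  assumes "length A = m" "set A \<subseteq> {1..n}" "r \<in> set (block m n A)"
  shows "r < last_vertex m n"
proof -
  have "m * sum_list A \<le> m * (m * n)"
    using sum_list_le_length_mult[OF assms(2)] assms(1) by (intro mult_le_mono2) simp
  then show ?thesis using assms(3)
    unfolding block_def last_vertex_def set_upt atLeastLessThan_iff by linarith
qed

lemma block_elem_mono:
  assumes "r \<in> set (block m n A)" "s \<in> set (block m n B)" "sum_list A < sum_list B"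
  shows "r \<le> s"
proof -
  \<comment> \<open>Distinct integer sums differ by at least 1, so the starts of the blocks differ
    by at least the block length \<open>m\<close>.\<close>
  have "m * Suc (sum_list A) \<le> m * sum_list B"
    using assms(3) by (intro mult_le_mono2) simp
  then show ?thesis using assms(1,2)
    unfolding block_def set_upt atLeastLessThan_iff mult_Suc_right by linarith
qed

lemma block_mono:
  assumes "sum_list A \<le> sum_list B"
  shows "list_all2 (\<le>) (block m n A) (block m n B)"
proof -
  have "m * sum_list A \<le> m * sum_list B"
    using assms by (rule mult_le_mono2)
  then show ?thesis by (auto simp: list_all2_conv_all_nth block_def simp del: upt_Suc)
qed

lemma comparable_commute: "comparable A B \<longleftrightarrow> comparable B A"
  by (auto simp: comparable_def)

lemma comparable_append_block_elem:
  assumes "comparable A B" "r \<in> set (block m n A)" "s \<in> set (block m n B)"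
  shows "comparable (A @ [r]) (B @ [s])"
  using assms
proof (induction "sum_list A" "sum_list B" arbitrary: A B r s rule: linorder_wlog)
  case le
  \<comment> \<open>Comparability in the other direction would force equal sums, hence
    \<open>A = B\<close>.\<close>
  have AB: "list_all2 (\<le>) A B"
    using le(1,2) list_all2_le_sum_list[of B A] list_all2_le_sum_list_eq[of B A]
    by (auto simp: comparable_def list_all2_refl)
  show ?case
  proof (cases "sum_list A = sum_list B")
    case True
    then have "A = B" using AB list_all2_le_sum_list_eq by blast
    then show ?thesis
      using linear[of r s] by (auto simp: comparable_def list_all2_refl intro!: list_all2_appendI)
  next
    case False
    then have "r \<le> s" using block_elem_mono[OF le(3,4)] le(1) by simp
    then show ?thesis using AB by (auto simp: comparable_def intro!: list_all2_appendI)
  qed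
next
  case sym
  then show ?case by (metis comparable_commute)
qed

lemma shift_chain_extend:
  assumes "shift_chain m n E"
  shows "shift_chain (Suc m) (last_vertex m n) (extend m n E)"
proof -
  have E: "length A = m" "set A \<subseteq> {1..n}" "sorted_wrt (<) A" if "A \<in> E" for A
    using assms that by (auto simp: shift_chain_def ordered_hypergraph_def)
  have comp: "comparable A B" if "A \<in> E" "B \<in> E" for A B
    using assms that by (auto simp: shift_chain_def)
  have less_last: "r < last_vertex m n" if "A \<in> E" "r \<in> set (block m n A)" for A r
    using block_less_last_vertex E that by blast
  have n_less: "n < last_vertex m n" by (simp add: last_vertex_def)
  \<comment> \<open>The vertex \<open>n\<close> separates \<open>A\<close> from all blocks, so edges
    of the first kind lie below those of the second.\<close>
  have mixed: "comparable (A @ [r]) (block m n B @ [last_vertex m n])"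
    if "A \<in> E" "r \<in> set (block m n A)" "B \<in> E" for A B r
  proof -
    have "list_all2 (\<le>) A (block m n B)"
      unfolding list_all2_conv_all_nth
    proof (intro conjI allI impI)
      fix i assume i: "i < length A"
      then have "A ! i \<le> n" using E(2)[OF that(1)] nth_mem by fastforce
      moreover have "n < block m n B ! i"
        using i E(1)[OF that(1)] by (intro block_gt[of _ m n B] nth_mem) simp
      ultimately show "A ! i \<le> block m n B ! i" by simp
    qed (simp add: E(1) that(1))
    then show ?thesis
      using less_last[OF that(1,2)] by (auto simp: comparable_def intro!: list_all2_appendI)
  qed
  \<comment> \<open>Any two blocks are translates of each other, and the last vertex is
    shared.\<close>
  have blocks: "comparable (block m n A @ [q]) (block m n B @ [q])" for A B q
    using block_mono[of A B m n] block_mono[of B A m n] linear[of "sum_list A" "sum_list B"]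
    by (auto simp: comparable_def intro!: list_all2_appendI)
  have "ordered_hypergraph (Suc m) (last_vertex m n) (extend m n E)"
    unfolding ordered_hypergraph_def
  proof (intro conjI ballI)
    fix X assume "X \<in> extend m n E"
    then consider A r where "X = A @ [r]" "A \<in> E" "r \<in> set (block m n A)"
      | A where "X = block m n A @ [last_vertex m n]" "A \<in> E"
      by (auto simp: extend_def)
    then have "length X = Suc m \<and> set X \<subseteq> {1..last_vertex m n} \<and> sorted_wrt (<) X"
    proof cases
      case 1
      then show ?thesis
        using E[of A] less_last[of A r] block_gt[of r m n A] n_less
        by (fastforce simp: sorted_wrt_append)
    next
      case 2
      have "sorted_wrt (<) (block m n A)" by (simp add: block_def del: upt_Suc)
      moreover have "\<forall>r\<in>set (block m n A). 1 \<le> r \<and> r < last_vertex m n"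
        using less_last[OF 2(2)] block_gt[of _ m n A] by fastforce
      ultimately show ?thesis
        using 2 n_less by (fastforce simp: sorted_wrt_append)
    qed
    then show "length X = Suc m" "set X \<subseteq> {1..last_vertex m n}" "sorted_wrt (<) X" by auto
  qed (simp add: last_vertex_def)
  moreover have "comparable X Y" if "X \<in> extend m n E" "Y \<in> extend m n E" for X Y
    using that unfolding extend_def
    by (auto intro: comparable_append_block_elem comp mixed blocks
        mixed[THEN comparable_commute[THEN iffD1]])
  ultimately show ?thesis by (simp add: shift_chain_def)
qed

text \<open>Used contrapositively: it carries the lack of a polychromatic coloring from
  \<open>E\<close> to the extension.\<close>

lemma polychromatic_3_coloring_extend:
  assumes "shift_chain m n E" and "polychromatic_3_coloring (last_vertex m n) (extend m n E) c"
  shows "polychromatic_3_coloring n E c"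
  unfolding polychromatic_3_coloring_def
proof (intro conjI ballI)
  show c: "c \<in> {1..n} \<rightarrow> {1, 2, 3}"
    using assms(2) by (auto simp: polychromatic_3_coloring_def last_vertex_def Pi_iff)
  fix A assume A: "A \<in> E"
  have colors: "c ` set X = {1, 2, 3}" if "X \<in> extend m n E" for X
    using assms(2) that by (simp add: polychromatic_3_coloring_def)
  have "set A \<subseteq> {1..n}"
    using assms(1) A by (auto simp: shift_chain_def ordered_hypergraph_def)
  then have sub: "c ` set A \<subseteq> {1, 2, 3}" using c by auto
  show "c ` set A = {1, 2, 3}"
  proof (rule ccontr)
    assume "c ` set A \<noteq> {1, 2, 3}"
    then obtain k where k: "k \<in> {1, 2, 3}" "k \<notin> c ` set A" using sub by blast
    have "c r = k" if "r \<in> set (block m n A)" for r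
    proof -
      have "A @ [r] \<in> extend m n E" using A that by (auto simp: extend_def)
      \<comment> \<open>Only \<open>r\<close> can supply the color \<open>k\<close> that
        \<open>A\<close> misses.\<close>
      from colors[OF this] have "insert (c r) (c ` set A) = {1, 2, 3}" by simp
      then show ?thesis using k by (metis insertE)
    qed
    then have "c ` set (block m n A @ [last_vertex m n]) \<subseteq> {k, c (last_vertex m n)}" by auto
    moreover have "block m n A @ [last_vertex m n] \<in> extend m n E"
      using A by (auto simp: extend_def)
    ultimately have "{1, 2, 3} \<subseteq> {k, c (last_vertex m n)}" using colors by metis
    then have "card {1, 2, 3 :: nat} \<le> card {k, c (last_vertex m n)}" by (intro card_mono) auto
    also have "\<dots> \<le> 2" by (simp add: card_insert_if)
    finally show False by simp
  qed
qed

theorem theorem1: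
  fixes m :: nat
  assumes "m \<ge> 1"
  shows "\<exists>n E. shift_chain m n E \<and> \<not> (\<exists>c. polychromatic_3_coloring n E c)"
proof (induction m)
  case 0
  \<comment> \<open>The induction starts from the empty edge, which sees no color at all.\<close>
  have "shift_chain 0 1 {[]}" "\<not> polychromatic_3_coloring 1 {[]} c" for c
    by (auto simp: shift_chain_def ordered_hypergraph_def comparable_def
        polychromatic_3_coloring_def)
  then show ?case by blast
next
  case (Suc m)
  then show ?case using shift_chain_extend polychromatic_3_coloring_extend by blast
qed

end
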